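(* There exist constants $c_1,c_2>0$ such that for every graph $G$: (1) if $G$ has chromatic number $k$, then the edge-length ratio of $G$ is at most $c_1\sqrt{k}+O(1)$; (2) if $G$ has edge-length ratio $h$, then the chromatic number of $G$ is at most $c_2 h^2+O(h)$.
   Context: A straight-line drawing of a graph maps vertices to points and edges to straight-line segments between their end-vertices; it is proper if no two vertices coincide and no edge overlaps a vertex not incident to it (crossings are allowed). The edge-length ratio of a drawing $\Gamma$ is $\max_{e_1,e_2\in E(G)} \ell_\Gamma(e_1)/\ell_\Gamma(e_2)$, where $\ell_\Gamma(e)$ is the Euclidean length of the segment representing $e$. The edge-length ratio of a graph $G$ is the minimum edge-length ratio over all (possibly nonplanar) proper straight-line drawings of $G$. *)

theory Defs
  imports "HOL-Analysis.Analysis"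
begin

definition simple_graph :: "'a set \<Rightarrow> 'a set set \<Rightarrow> bool" where
  "simple_graph V E \<longleftrightarrow> finite V \<and> (\<forall>e\<in>E. e \<subseteq> V \<and> card e = 2)"

definition proper_colouring :: "'a set \<Rightarrow> 'a set set \<Rightarrow> nat \<Rightarrow> ('a \<Rightarrow> nat) \<Rightarrow> bool" where
  "proper_colouring V E k c \<longleftrightarrow> c ` V \<subseteq> {..<k} \<and> (\<forall>u v. {u, v} \<in> E \<longrightarrow> c u \<noteq> c v)"

definition chromatic_number :: "'a set \<Rightarrow> 'a set set \<Rightarrow> nat" where
  "chromatic_number V E = (LEAST k. \<exists>c. proper_colouring V E k c)"

text \<open>A straight-line drawing is given by the positions of the vertices; only its values on
  the vertex set matter. The edge \<open>{u, v}\<close> is drawn as the segment from \<open>D u\<close> to \<open>D v\<close>.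
  Edges may cross.\<close>

definition proper_drawing :: "'a set \<Rightarrow> 'a set set \<Rightarrow> ('a \<Rightarrow> real ^ 2) \<Rightarrow> bool" where
  "proper_drawing V E D \<longleftrightarrow>
     inj_on D V \<and>
     (\<forall>u v w. {u, v} \<in> E \<longrightarrow> w \<in> V - {u, v} \<longrightarrow> D w \<notin> closed_segment (D u) (D v))"

definition edge_lengths :: "'a set set \<Rightarrow> ('a \<Rightarrow> real ^ 2) \<Rightarrow> real set" where
  "edge_lengths E D = {dist (D u) (D v) | u v. {u, v} \<in> E}"

text \<open>A graph without edges has no ratios to compare; its drawings get the ratio 1, the least
  value that a drawing of a graph with edges can have.\<close>

definition drawing_ratio :: "'a set set \<Rightarrow> ('a \<Rightarrow> real ^ 2) \<Rightarrow> real" where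
  "drawing_ratio E D =
     (if E = {} then 1
      else Max {l1 / l2 | l1 l2. l1 \<in> edge_lengths E D \<and> l2 \<in> edge_lengths E D})"

text \<open>An infimum, because the minimum need not be attained: the complete bipartite graph with
  parts of size 3 has proper drawings of ratio arbitrarily close to 1 (put each part close to
  one of two points), but none of ratio 1 (two distinct points of the plane have at most two
  common neighbours at a fixed distance).\<close>

definition edge_length_ratio :: "'a set \<Rightarrow> 'a set set \<Rightarrow> real" where
  "edge_length_ratio V E = Inf {drawing_ratio E D | D. proper_drawing V E D}"

end

theory Submission
  imports Defs
begin

text \<open>For the first part, put the colour classes close to distinct points of a square grid with
  \<open>\<lceil>sqrt k\<rceil>\<close> points on each side, perturbing the vertices so that no three are collinear: edges join
  different classes, so all lengths lie between \<open>1/2\<close> and \<open>O(sqrt k)\<close>. For the second part, cut the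
  plane into squares of side half the shortest edge length, so that each square holds an
  independent set, and colour the squares periodically with a period slightly larger than the
  longest edge.\<close>

section \<open>Edge lengths and the ratio of a single drawing\<close>

lemma simple_graph_edgeD:
  assumes "simple_graph V E" "{u, v} \<in> E"
  shows "u \<in> V" "v \<in> V" "u \<noteq> v"
  using assms by (force simp: simple_graph_def)+

lemma edge_lengths_nonempty:
  assumes "simple_graph V E" "E \<noteq> {}"
  shows "edge_lengths E D \<noteq> {}"
proof -
  obtain e where "e \<in> E" using assms by blast
  moreover from this have "card e = 2" using assms by (auto simp: simple_graph_def)
  ultimately obtain u v where "{u, v} \<in> E" by (metis card_2_iff)
  then show ?thesis by (auto simp: edge_lengths_def)
qed

lemma finite_edge_lengths:
  assumes "simple_graph V E"
  shows "finite (edge_lengths E D)"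
proof (rule finite_subset)
  show "edge_lengths E D \<subseteq> (\<lambda>(u, v). dist (D u) (D v)) ` (V \<times> V)"
    using simple_graph_edgeD[OF assms] by (fastforce simp: edge_lengths_def)
  show "finite ((\<lambda>(u, v). dist (D u) (D v)) ` (V \<times> V))"
    using assms by (simp add: simple_graph_def)
qed

lemma edge_lengths_pos:
  assumes "simple_graph V E" "proper_drawing V E D" "l \<in> edge_lengths E D"
  shows "l > 0"
proof -
  obtain u v where "{u, v} \<in> E" "l = dist (D u) (D v)"
    using assms by (auto simp: edge_lengths_def)
  then show ?thesis
    using simple_graph_edgeD[OF assms(1), of u v] assms(2)
    by (auto simp: proper_drawing_def inj_on_def)
qed

text \<open>Needed so that \<open>Max\<close> in \<open>drawing_ratio\<close> is a genuine
  maximum.\<close>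

lemma finite_length_quotients:
  assumes "simple_graph V E"
  shows "finite {l1 / l2 | l1 l2. l1 \<in> edge_lengths E D \<and> l2 \<in> edge_lengths E D}"
proof -
  have "{l1 / l2 | l1 l2. l1 \<in> edge_lengths E D \<and> l2 \<in> edge_lengths E D}
      = (\<lambda>(l1, l2). l1 / l2) ` (edge_lengths E D \<times> edge_lengths E D)" by auto
  then show ?thesis using finite_edge_lengths[OF assms] by simp
qed

lemma length_quotient_le_drawing_ratio:
  assumes "simple_graph V E" "l1 \<in> edge_lengths E D" "l2 \<in> edge_lengths E D"
  shows "l1 / l2 \<le> drawing_ratio E D"
proof -
  have "E \<noteq> {}" using assms by (auto simp: edge_lengths_def)
  moreover have "l1 / l2 \<in> {l1 / l2 | l1 l2. l1 \<in> edge_lengths E D \<and> l2 \<in> edge_lengths E D}"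
    using assms by blast
  ultimately show ?thesis
    using finite_length_quotients[OF assms(1)] by (simp add: drawing_ratio_def)
qed

lemma drawing_ratio_le:
  assumes "simple_graph V E" "E \<noteq> {}"
    and "\<And>l1 l2. l1 \<in> edge_lengths E D \<Longrightarrow> l2 \<in> edge_lengths E D \<Longrightarrow> l1 / l2 \<le> B"
  shows "drawing_ratio E D \<le> B"
proof -
  let ?Q = "{l1 / l2 | l1 l2. l1 \<in> edge_lengths E D \<and> l2 \<in> edge_lengths E D}"
  have "?Q \<noteq> {}" using edge_lengths_nonempty[OF assms(1,2)] by blast
  then have "Max ?Q \<le> B"
    using assms(3) by (intro Max.boundedI finite_length_quotients[OF assms(1)]) auto
  then show ?thesis using assms(2) by (simp add: drawing_ratio_def)
qed

lemma drawing_ratio_ge_1: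
  assumes "simple_graph V E" "proper_drawing V E D"
  shows "1 \<le> drawing_ratio E D"
proof (cases "E = {}")
  case False
  then obtain l where l: "l \<in> edge_lengths E D" using edge_lengths_nonempty[OF assms(1)] by blast
  then have "l / l = 1" using edge_lengths_pos[OF assms] by fastforce
  then show ?thesis using length_quotient_le_drawing_ratio[OF assms(1) l l] by simp
qed (simp add: drawing_ratio_def)

text \<open>A real \<open>Inf\<close> lies below the members of a set once the set is bounded below;
  here 1 is a bound, because an edge can be compared with itself.\<close>

lemma edge_length_ratio_le:
  assumes "simple_graph V E" "proper_drawing V E D"
  shows "edge_length_ratio V E \<le> drawing_ratio E D"
  unfolding edge_length_ratio_def
  using assms by (auto intro!: cInf_lower bdd_belowI[of _ 1] drawing_ratio_ge_1)

section \<open>Proper drawings close to prescribed points\<close>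

lemma general_position_near:
  fixes S :: "(real ^ 2) set"
  assumes "finite S" "\<epsilon> > 0"
  shows "\<exists>x \<in> ball p \<epsilon>. \<forall>a\<in>S. \<forall>b\<in>S. x \<notin> affine hull {a, b}"
proof -
  let ?U = "\<Union>(a, b) \<in> S \<times> S. affine hull {a, b}"
  \<comment> \<open>The hull is a line, or a point if \<open>a = b\<close>: a convex set with empty
    interior in the plane, hence null. Finitely many such sets cannot cover a ball.\<close>
  have "negligible (affine hull {a, b})" for a b :: "real ^ 2"
    using empty_interior_affine_hull[of "{a, b}"] affine_imp_convex[OF affine_affine_hull]
    by (simp add: negligible_convex_interior card_insert_if)
  then have "negligible ?U" using assms by (intro negligible_Union) auto
  moreover have "\<not> negligible (ball p \<epsilon>)" using assms(2) by (simp add: open_not_negligible)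
  ultimately have "\<not> ball p \<epsilon> \<subseteq> ?U" using negligible_subset by blast
  then show ?thesis by blast
qed

text \<open>Vertices are placed one at a time, each off all lines through earlier points.
  Quantifying over all pairs of vertices instead of edges keeps the induction free of the edge
  set.\<close>

lemma exists_proper_drawing_near:
  fixes p :: "'a \<Rightarrow> real ^ 2"
  assumes "finite V" "\<epsilon> > 0"
  shows "\<exists>D. (\<forall>v\<in>V. dist (p v) (D v) < \<epsilon>) \<and> inj_on D V \<and>
    (\<forall>u\<in>V. \<forall>v\<in>V. \<forall>w\<in>V - {u, v}. D w \<notin> closed_segment (D u) (D v))"
  using assms(1)
proof (induction V)
  case (insert x V)
  then obtain D where D: "\<And>v. v \<in> V \<Longrightarrow> dist (p v) (D v) < \<epsilon>" "inj_on D V"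
    "\<And>u v w. u \<in> V \<Longrightarrow> v \<in> V \<Longrightarrow> w \<in> V - {u, v} \<Longrightarrow> D w \<notin> closed_segment (D u) (D v)"
    by blast
  obtain y where y: "dist (p x) y < \<epsilon>"
    "\<And>a b. a \<in> V \<Longrightarrow> b \<in> V \<Longrightarrow> y \<notin> affine hull {D a, D b}"
    using general_position_near[of "D ` V" \<epsilon> "p x"] insert.hyps assms(2) by auto
  \<comment> \<open>Case \<open>a = b\<close> of the choice of \<open>y\<close>: the hull is then a
    single point.\<close>
  have y_notin: "y \<noteq> D a" if "a \<in> V" for a
    using y(2)[OF that that] by (metis hull_inc insertI1)
  \<comment> \<open>An old point on a segment ending at \<open>y\<close> would put \<open>y\<close>
    on the line through two old points.\<close>
  have seg: "D w \<notin> closed_segment y (D u)" if "u \<in> V" "w \<in> V" "w \<noteq> u" for u w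
  proof
    assume "D w \<in> closed_segment y (D u)"
    moreover have "D w \<noteq> D u" using D(2) that by (auto simp: inj_on_def)
    moreover have "collinear {D u, D w, y}"
      using calculation(1) between_imp_collinear[of y "D u" "D w"]
      by (simp add: between_mem_segment insert_commute)
    ultimately have "y \<in> affine hull {D u, D w}"
      using collinear_3_imp_in_affine_hull[of "D u" "D w" y] by simp
    then show False using y(2) that by blast
  qed
  have seg': "y \<notin> closed_segment (D u) (D v)" if "u \<in> V" "v \<in> V" for u v
    using y(2)[OF that] convex_hull_subset_affine_hull[of "{D u, D v}"]
    by (auto simp: segment_convex_hull)
  let ?D = "D(x := y)"
  have "inj_on ?D (insert x V)"
    using D(2) y_notin insert.hyps by (auto simp: inj_on_def)
  moreover have "\<forall>v\<in>insert x V. dist (p v) (?D v) < \<epsilon>" using D(1) y(1) by auto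
  moreover have "?D w \<notin> closed_segment (?D u) (?D v)"
    if "u \<in> insert x V" "v \<in> insert x V" "w \<in> insert x V - {u, v}" for u v w
    using that D(3)[of u v w] seg[of u w] seg[of v w] seg'[of u v] y_notin[of w] insert.hyps
    by (auto simp: closed_segment_commute split: if_splits)
  ultimately show ?case by blast
qed simp

text \<open>The map \<open>p\<close> may be far from injective: later, all vertices of one colour
  share a target point.\<close>

lemma proper_drawing_near:
  fixes p :: "'a \<Rightarrow> real ^ 2"
  assumes "simple_graph V E" "\<epsilon> > 0"
  obtains D where "proper_drawing V E D" "\<And>v. v \<in> V \<Longrightarrow> dist (p v) (D v) < \<epsilon>"
proof -
  have "finite V" using assms by (simp add: simple_graph_def)
  from exists_proper_drawing_near[OF this assms(2), of p] obtain D
    where D: "\<forall>v\<in>V. dist (p v) (D v) < \<epsilon>" "inj_on D V"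
      "\<forall>u\<in>V. \<forall>v\<in>V. \<forall>w\<in>V - {u, v}. D w \<notin> closed_segment (D u) (D v)" by blast
  then have "proper_drawing V E D"
    using simple_graph_edgeD[OF assms(1)] unfolding proper_drawing_def by blast
  then show thesis using that D(1) by blast
qed

section \<open>The edge-length ratio as an infimum\<close>

lemma edge_length_ratio_approx:
  assumes "simple_graph V E" "edge_length_ratio V E < r"
  obtains D where "proper_drawing V E D" "drawing_ratio E D < r"
proof -
  \<comment> \<open>The set of ratios must be nonempty before a member close to its infimum can be
    chosen.\<close>
  obtain D0 where "proper_drawing V E D0"
    using proper_drawing_near[OF assms(1) zero_less_one] by metis
  then have "{drawing_ratio E D | D. proper_drawing V E D} \<noteq> {}" by auto
  from cInf_lessD[OF this assms(2)[unfolded edge_length_ratio_def]] show thesis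
    using that by auto
qed

lemma edge_length_ratio_ge_1:
  assumes "simple_graph V E"
  shows "1 \<le> edge_length_ratio V E"
proof (rule ccontr)
  assume "\<not> ?thesis"
  then obtain D where "proper_drawing V E D" "drawing_ratio E D < 1"
    using edge_length_ratio_approx[OF assms, of 1] by auto
  then show False using drawing_ratio_ge_1[OF assms] by fastforce
qed

lemma edge_length_ratio_no_edges:
  assumes "simple_graph V {}"
  shows "edge_length_ratio V {} = 1"
proof -
  obtain D where "proper_drawing V {} D"
    using proper_drawing_near[OF assms zero_less_one] by metis
  then have "edge_length_ratio V {} \<le> 1"
    using edge_length_ratio_le[OF assms] by (simp add: drawing_ratio_def)
  then show ?thesis using edge_length_ratio_ge_1[OF assms] by simp
qed

section \<open>Colourings and the chromatic number\<close>

lemma chromatic_number_le: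
  "proper_colouring V E k c \<Longrightarrow> chromatic_number V E \<le> k"
  unfolding chromatic_number_def by (auto intro: Least_le)

lemma chromatic_number_colouring:
  assumes "simple_graph V E"
  obtains c where "proper_colouring V E (chromatic_number V E) c"
proof -
  \<comment> \<open>Giving every vertex its own colour shows that some \<open>k\<close> is
    admissible, so the \<open>LEAST\<close> is attained.\<close>
  obtain f :: "'a \<Rightarrow> nat" where "bij_betw f V {..<card V}"
    using assms finite_same_card_bij[of V "{..<card V}"] by (auto simp: simple_graph_def)
  then have "f ` V \<subseteq> {..<card V}" "inj_on f V" by (auto simp: bij_betw_def)
  then have "proper_colouring V E (card V) f"
    using simple_graph_edgeD[OF assms] unfolding proper_colouring_def by (meson inj_onD)
  then show thesis
    using LeastI[of "\<lambda>k. \<exists>c. proper_colouring V E k c" "card V"] that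
    unfolding chromatic_number_def by blast
qed

section \<open>Bounding the ratio: colour classes on a square grid\<close>

definition grid_point :: "nat \<Rightarrow> nat \<Rightarrow> real ^ 2" where
  "grid_point m i = vector [real (i mod m), real (i div m)]"

text \<open>Quotient and remainder determine the index, so distinct indices give lattice points
  differing by at least 1 in some coordinate.\<close>

lemma grid_point_dist_ge:
  assumes "i \<noteq> j"
  shows "1 \<le> dist (grid_point m i) (grid_point m j)"
proof -
  have "i mod m \<noteq> j mod m \<or> i div m \<noteq> j div m"
    using assms by (metis div_mult_mod_eq)
  then have "1 \<le> \<bar>real (i mod m) - real (j mod m)\<bar> \<or> 1 \<le> \<bar>real (i div m) - real (j div m)\<bar>"
    by linarith
  then show ?thesis
    using component_le_norm_cart[of "grid_point m i - grid_point m j" 1]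
      component_le_norm_cart[of "grid_point m i - grid_point m j" 2]
    by (auto simp: dist_norm grid_point_def)
qed

text \<open>Indices below \<open>m * m\<close> fill an \<open>m\<close> by \<open>m\<close> square
  row by row. Bounding the Euclidean norm by the sum of the coordinates gives the factor 2.\<close>

lemma grid_point_dist_le:
  assumes "i < m * m" "j < m * m"
  shows "dist (grid_point m i) (grid_point m j) \<le> 2 * real m"
proof -
  have "m > 0" using assms by (cases m) auto
  then have "i mod m < m" "j mod m < m" "i div m < m" "j div m < m"
    using assms by (auto simp: less_mult_imp_div_less)
  then have "\<bar>real (i mod m) - real (j mod m)\<bar> \<le> m" "\<bar>real (i div m) - real (j div m)\<bar> \<le> m"
    by linarith+
  then show ?thesis
    using norm_le_l1_cart[of "grid_point m i - grid_point m j"]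
    by (auto simp: dist_norm grid_point_def sum_2)
qed

lemma edge_length_ratio_le_chromatic_number:
  assumes G: "simple_graph V E"
  shows "edge_length_ratio V E \<le> 4 * sqrt (real (chromatic_number V E)) + 5"
proof (cases "E = {}")
  case True
  then have "edge_length_ratio V E = 1" using edge_length_ratio_no_edges G by blast
  then show ?thesis by (simp add: add_increasing)
next
  case False
  define k where "k = chromatic_number V E"
  define m where "m = nat \<lceil>sqrt (real k)\<rceil>"
  have m: "sqrt k \<le> real m" "real m \<le> sqrt k + 1"
    unfolding m_def by (auto simp: of_nat_nat)
  have "real k \<le> real (m * m)"
    using m(1) power_mono[OF m(1), of 2] by (simp add: power2_eq_square)
  then have km: "k \<le> m * m" by linarith
  obtain c where c: "proper_colouring V E k c"
    using chromatic_number_colouring[OF G] unfolding k_def .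
  \<comment> \<open>Moving both ends by less than 1/4 changes a distance by less than 1/2, so edges,
    which join different grid points at distance at least 1, keep length at least 1/2.\<close>
  obtain D where D: "proper_drawing V E D"
    "\<And>v. v \<in> V \<Longrightarrow> dist (grid_point m (c v)) (D v) < 1/4"
    using proper_drawing_near[OF G, of "1/4" "\<lambda>v. grid_point m (c v)"] by auto
  have len: "1/2 \<le> l \<and> l \<le> 2 * real m + 1/2" if l: "l \<in> edge_lengths E D" for l
  proof -
    obtain u v where e: "{u, v} \<in> E" "l = dist (D u) (D v)"
      using l by (auto simp: edge_lengths_def)
    have uv: "u \<in> V" "v \<in> V" using simple_graph_edgeD[OF G e(1)] by auto
    have cuv: "c u \<noteq> c v" "c u < m * m" "c v < m * m"
      using c e uv km by (fastforce simp: proper_colouring_def)+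
    let ?p = "grid_point m (c u)" and ?q = "grid_point m (c v)"
    have near: "dist ?p (D u) < 1/4" "dist ?q (D v) < 1/4" using D(2) uv by auto
    have "dist ?p ?q \<le> dist ?p (D u) + dist (D u) (D v) + dist ?q (D v)"
      "dist (D u) (D v) \<le> dist ?p (D u) + dist ?p ?q + dist ?q (D v)"
      by metric+
    then show ?thesis
      using near grid_point_dist_ge[OF cuv(1), of m] grid_point_dist_le[OF cuv(2,3)] e(2)
      by linarith
  qed
  have "drawing_ratio E D \<le> 4 * real m + 1"
  proof (rule drawing_ratio_le[OF G False])
    fix l1 l2 assume "l1 \<in> edge_lengths E D" "l2 \<in> edge_lengths E D"
    then have "1/2 \<le> l2" "l1 \<le> 2 * real m + 1/2" using len by auto
    have "l1 \<le> (4 * real m + 1) * (1/2)" using \<open>l1 \<le> _\<close> by simp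
    also have "\<dots> \<le> (4 * real m + 1) * l2" using \<open>1/2 \<le> l2\<close> by (intro mult_left_mono) auto
    finally have "l1 \<le> (4 * real m + 1) * l2" .
    then show "l1 / l2 \<le> 4 * real m + 1" using \<open>1/2 \<le> l2\<close> by (simp add: divide_le_eq)
  qed
  \<comment> \<open>Rounding up costs at most 1: \<open>4 * m + 1\<close> is at most
    \<open>4 * (sqrt k + 1) + 1\<close>.\<close>
  then show ?thesis using edge_length_ratio_le[OF G D(1)] m(2) unfolding k_def by linarith
qed

section \<open>Bounding the chromatic number: periodic colouring of square cells\<close>

lemma abs_diff_gt_of_floor_mod_eq:
  fixes x y s :: real and N :: int
  assumes "s > 0" "N > 0" "\<lfloor>x / s\<rfloor> mod N = \<lfloor>y / s\<rfloor> mod N" "\<lfloor>x / s\<rfloor> \<noteq> \<lfloor>y / s\<rfloor>"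
  shows "(real_of_int N - 1) * s < \<bar>x - y\<bar>"
proof -
  have "N dvd \<lfloor>x / s\<rfloor> - \<lfloor>y / s\<rfloor>" using assms(3) by (simp add: mod_eq_dvd_iff)
  then have "N \<le> \<bar>\<lfloor>x / s\<rfloor> - \<lfloor>y / s\<rfloor>\<bar>"
    using assms(4) dvd_imp_le_int[of "\<lfloor>x / s\<rfloor> - \<lfloor>y / s\<rfloor>" N] assms(2) by auto
  \<comment> \<open>Distinct congruent cell indices differ by at least \<open>N\<close>; removing
    the floors loses less than 1.\<close>
  then have "real_of_int N - 1 < \<bar>x / s - y / s\<bar>" by linarith
  also have "\<dots> = \<bar>x - y\<bar> / s" using assms(1) by (simp flip: diff_divide_distrib)
  finally show ?thesis using assms(1) by (simp add: less_divide_eq)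
qed

lemma chromatic_number_le_drawing_ratio:
  assumes G: "simple_graph V E" and D: "proper_drawing V E D"
  shows "real (chromatic_number V E) \<le> (2 * drawing_ratio E D + 2)\<^sup>2"
proof (cases "E = {}")
  case True
  \<comment> \<open>With the default ratio 1 the bound is 16, and one colour suffices.\<close>
  then have "proper_colouring V E 1 (\<lambda>_. 0)" by (auto simp: proper_colouring_def)
  from chromatic_number_le[OF this] show ?thesis using True by (simp add: drawing_ratio_def)
next
  case False
  define r where "r = drawing_ratio E D"
  define l where "l = Min (edge_lengths E D)"
  define s where "s = l / 2"
  \<comment> \<open>The longest edge is at most \<open>r * l = 2 * r * s\<close>, so the period must
    satisfy \<open>n - 1 \<ge> 2 * r\<close>; the added 1 pays for the floors.\<close>
  define n where "n = nat \<lceil>2 * r\<rceil> + 1"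
  have r1: "1 \<le> r" using drawing_ratio_ge_1[OF G D] by (simp add: r_def)
  have "real n = of_int \<lceil>2 * r\<rceil> + 1" using r1 by (simp add: n_def)
  then have n: "2 * r \<le> real n - 1" "real n \<le> 2 * r + 2" "n > 0"
    using r1 by (linarith, linarith, simp add: n_def)
  have lin: "l \<in> edge_lengths E D"
    unfolding l_def using finite_edge_lengths[OF G] edge_lengths_nonempty[OF G False] by simp
  then have l0: "l > 0" using edge_lengths_pos[OF G D] by blast
  then have s0: "s > 0" by (simp add: s_def)
  have len: "l \<le> dist (D u) (D v) \<and> dist (D u) (D v) \<le> r * l" if "{u, v} \<in> E" for u v
  proof -
    have m: "dist (D u) (D v) \<in> edge_lengths E D" using that by (auto simp: edge_lengths_def)
    show ?thesis
      using length_quotient_le_drawing_ratio[OF G m lin] l0 m finite_edge_lengths[OF G]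
      unfolding r_def by (auto simp: l_def divide_le_eq)
  qed
  define cell where "cell v i = \<lfloor>D v $ i / s\<rfloor>" for v i
  \<comment> \<open>The two residues are the digits of a number in base \<open>n\<close>, so
    \<open>n * n\<close> colours are enough and the colour determines both residues.\<close>
  define c where "c v = nat (cell v 1 mod int n) * n + nat (cell v 2 mod int n)" for v
  have lt: "nat (cell v i mod int n) < n" for v i using n(3) by (simp add: nat_less_iff)
  have "c v < n * n" for v
  proof -
    have "Suc (nat (cell v 1 mod int n)) * n \<le> n * n"
      using lt[of v 1] by (intro mult_le_mono1) simp
    then show ?thesis using lt[of v 2] by (simp add: c_def)
  qed
  moreover have "c u \<noteq> c v" if e: "{u, v} \<in> E" for u v
  proof
    assume "c u = c v"
    have "c w div n = nat (cell w 1 mod int n)" "c w mod n = nat (cell w 2 mod int n)" for w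
      unfolding c_def using lt[of w 1] lt[of w 2] n(3) by auto
    from this[of u] this[of v] have "nat (cell u i mod int n) = nat (cell v i mod int n)" for i
      using \<open>c u = c v\<close> exhaust_2[of i] by auto
    then have eq: "cell u i mod int n = cell v i mod int n" for i
      using n(3) by (simp add: eq_nat_nat_iff)
    show False
    \<comment> \<open>Equally coloured points in different cells are farther apart than the longest
      edge; points in one cell differ by less than \<open>l / 2\<close> in each coordinate, so they
      are closer than the shortest edge.\<close>
    proof (cases "\<exists>i. cell u i \<noteq> cell v i")
      case True
      then obtain i where "cell u i \<noteq> cell v i" by blast
      then have "(real n - 1) * s < \<bar>D u $ i - D v $ i\<bar>"
        using abs_diff_gt_of_floor_mod_eq[of s "int n" "D u $ i" "D v $ i"] eq[of i] n(3) l0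
        by (simp add: cell_def s_def)
      also have "\<dots> \<le> dist (D u) (D v)"
        using component_le_norm_cart[of "D u - D v" i] by (simp add: dist_norm)
      also have "\<dots> \<le> (2 * r) * s" using len[OF e] by (simp add: s_def)
      also have "\<dots> \<le> (real n - 1) * s" using n(1) l0 by (intro mult_right_mono) (auto simp: s_def)
      finally show False by simp
    next
      case False
      have "\<bar>D u $ i - D v $ i\<bar> < s" for i
      proof -
        have "\<lfloor>D u $ i / s\<rfloor> = \<lfloor>D v $ i / s\<rfloor>" using False by (simp add: cell_def)
        then have "\<bar>D u $ i / s - D v $ i / s\<bar> < 1" by linarith
        then have "\<bar>D u $ i - D v $ i\<bar> / s < 1"
          using s0 by (simp flip: diff_divide_distrib)
        then show ?thesis using s0 by (simp add: divide_less_eq)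
      qed
      from this[of 1] this[of 2] have "dist (D u) (D v) < l"
        using norm_le_l1_cart[of "D u - D v"] by (simp add: dist_norm sum_2 s_def)
      then show False using len[OF e] by simp
    qed
  qed
  ultimately have "proper_colouring V E (n * n) c" by (auto simp: proper_colouring_def)
  from chromatic_number_le[OF this] have "real (chromatic_number V E) \<le> real n ^ 2"
    by (simp add: power2_eq_square flip: of_nat_mult)
  also have "\<dots> \<le> (2 * r + 2)\<^sup>2" using n(2) by (intro power_mono) auto
  finally show ?thesis by (simp add: r_def)
qed

text \<open>As the infimum may not be attained, a drawing of ratio below \<open>h + 1\<close> is
  used. Since \<open>h \<ge> 1\<close>, \<open>2 * (h + 1) + 2 \<le> 6 * h\<close>, whence
  36.\<close>

lemma chromatic_number_le_edge_length_ratio: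
  assumes "simple_graph V E"
  shows "real (chromatic_number V E) \<le> 36 * (edge_length_ratio V E)\<^sup>2"
proof -
  let ?h = "edge_length_ratio V E"
  obtain D where D: "proper_drawing V E D" "drawing_ratio E D < ?h + 1"
    using edge_length_ratio_approx[OF assms, of "?h + 1"] by auto
  have "real (chromatic_number V E) \<le> (2 * drawing_ratio E D + 2)\<^sup>2"
    using chromatic_number_le_drawing_ratio[OF assms D(1)] .
  also have "\<dots> \<le> (6 * ?h)\<^sup>2"
    using D(2) drawing_ratio_ge_1[OF assms D(1)] edge_length_ratio_ge_1[OF assms]
    by (intro power_mono) auto
  finally show ?thesis by (simp add: power_mult_distrib)
qed

theorem theorem5:
  "\<exists>c1 c2 C1 C2 :: real. c1 > 0 \<and> c2 > 0 \<and>
     (\<forall>(V :: 'a set) E. simple_graph V E \<longrightarrow>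
        (\<forall>k. chromatic_number V E = k \<longrightarrow>
           edge_length_ratio V E \<le> c1 * sqrt (real k) + C1) \<and>
        (\<forall>h. edge_length_ratio V E = h \<longrightarrow>
           real (chromatic_number V E) \<le> c2 * h\<^sup>2 + C2 * h))"
  using edge_length_ratio_le_chromatic_number chromatic_number_le_edge_length_ratio
  \<comment> \<open>The linear term gets coefficient 0, being already absorbed into
    \<open>36 * h\<^sup>2\<close>.\<close>
  by (intro exI[of _ 4] exI[of _ 36] exI[of _ 5] exI[of _ 0]) auto

end
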